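(* Let $\tilde{\mathfrak g}$ be the $5$-dimensional real Lie algebra with basis $\{e_1,\dots,e_5\}$ whose nonzero brackets (up to antisymmetry) are $$[e_1,e_2]=-e_3,\quad [e_4,e_2]=-e_1,\quad [e_4,e_1]=e_2,\quad [e_5,e_1]=-e_1+e_3,$$ $$[e_5,e_2]=-e_2,\quad [e_5,e_3]=-2e_3,\quad [e_5,e_4]=e_1+\tfrac{7}{12}e_3,$$ and let $\tilde g$ be the symmetric bilinear form on $\tilde{\mathfrak g}$ whose only nonzero components $\tilde g_{ij}=\tilde g(e_i,e_j)$ are $$\tilde g_{11}=\tfrac{497}{576},\quad \tilde g_{22}=\tfrac{49}{192},\quad \tilde g_{33}=2,\quad \tilde g_{13}=\tilde g_{31}=-\tfrac{7}{6},\quad \tilde g_{44}=-\tfrac{245}{6144},\quad \tilde g_{55}=-\tfrac{1225}{6144}.$$ Let $\mathfrak n$ be the nilradical of $\tilde{\mathfrak g}$ and let $\mathfrak h=\mathfrak n^{\perp}$ be its orthogonal complement in $\tilde{\mathfrak g}$ with respect to $\tilde g$. Then $\mathfrak h$ is not contained in any abelian subalgebra of $\tilde{\mathfrak g}$.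
   Context: The nilradical of a Lie algebra is its maximal nilpotent ideal. The orthogonal complement of a subspace $V$ is $V^{\perp}=\{x\in\tilde{\mathfrak g} : \tilde g(x,v)=0 \text{ for all } v\in V\}$. *)

theory Defs
  imports "HOL-Analysis.Analysis"
begin

section \<open>Real Lie algebras\<close>

locale lie_algebra =
  fixes bracket :: "'a::real_vector \<Rightarrow> 'a \<Rightarrow> 'a"
  assumes bilinear_bracket: "bilinear bracket"
    and bracket_self: "bracket x x = 0"
    and jacobi:
      "bracket x (bracket y z) + bracket y (bracket z x) + bracket z (bracket x y) = 0"
begin

definition subalgebra :: "'a set \<Rightarrow> bool" where
  "subalgebra A \<longleftrightarrow> subspace A \<and> (\<forall>x\<in>A. \<forall>y\<in>A. bracket x y \<in> A)"

definition abelian :: "'a set \<Rightarrow> bool" where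
  "abelian A \<longleftrightarrow> (\<forall>x\<in>A. \<forall>y\<in>A. bracket x y = 0)"

definition lie_ideal :: "'a set \<Rightarrow> bool" where
  "lie_ideal I \<longleftrightarrow> subspace I \<and> (\<forall>x. \<forall>y\<in>I. bracket x y \<in> I)"

text \<open>The lower central series is that of \<open>A\<close> as a Lie algebra in its own right: brackets
  are taken with elements of \<open>A\<close> only, not with those of the ambient algebra.\<close>

primrec lower_central :: "'a set \<Rightarrow> nat \<Rightarrow> 'a set" where
  "lower_central A 0 = A"
| "lower_central A (Suc n) = span {bracket x y | x y. x \<in> A \<and> y \<in> lower_central A n}"

definition nilpotent :: "'a set \<Rightarrow> bool" where
  "nilpotent A \<longleftrightarrow> (\<exists>n. lower_central A n = {0})"

text \<open>Maximality is meant with respect to inclusion among all nilpotent ideals, that is, the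
  nilradical is the nilpotent ideal containing every other one. It is unique if it exists, and
  it exists in finite dimension.\<close>

definition nilradical :: "'a set" where
  "nilradical = (THE N. lie_ideal N \<and> nilpotent N \<and>
     (\<forall>I. lie_ideal I \<and> nilpotent I \<longrightarrow> I \<subseteq> N))"

end

definition orth_compl :: "('a \<Rightarrow> 'a \<Rightarrow> real) \<Rightarrow> 'a set \<Rightarrow> 'a set" where
  "orth_compl B V = {x. \<forall>v\<in>V. B x v = 0}"


section \<open>The five-dimensional example\<close>

definition e :: "5 \<Rightarrow> real ^ 5" where
  "e i = axis i 1"

text \<open>The listed brackets, one order of each pair; the other order and the remaining pairs
  are filled in by antisymmetrising in \<open>bracket5\<close>.\<close>

definition bracket_table :: "5 \<Rightarrow> 5 \<Rightarrow> real ^ 5" where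
  "bracket_table i j =
    (if i = 1 \<and> j = 2 then - e 3
     else if i = 4 \<and> j = 2 then - e 1
     else if i = 4 \<and> j = 1 then e 2
     else if i = 5 \<and> j = 1 then - e 1 + e 3
     else if i = 5 \<and> j = 2 then - e 2
     else if i = 5 \<and> j = 3 then (- 2) *\<^sub>R e 3
     else if i = 5 \<and> j = 4 then e 1 + (7/12) *\<^sub>R e 3
     else 0)"

definition bracket5 :: "real ^ 5 \<Rightarrow> real ^ 5 \<Rightarrow> real ^ 5" where
  "bracket5 x y =
    (\<Sum>i\<in>UNIV. \<Sum>j\<in>UNIV. (x $ i * y $ j) *\<^sub>R (bracket_table i j - bracket_table j i))"

definition metric_table :: "5 \<Rightarrow> 5 \<Rightarrow> real" where
  "metric_table i j =
    (if i = 1 \<and> j = 1 then 497/576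
     else if i = 2 \<and> j = 2 then 49/192
     else if i = 3 \<and> j = 3 then 2
     else if i = 1 \<and> j = 3 \<or> i = 3 \<and> j = 1 then - (7/6)
     else if i = 4 \<and> j = 4 then - (245/6144)
     else if i = 5 \<and> j = 5 then - (1225/6144)
     else 0)"

definition metric5 :: "real ^ 5 \<Rightarrow> real ^ 5 \<Rightarrow> real" where
  "metric5 x y = (\<Sum>i\<in>UNIV. \<Sum>j\<in>UNIV. x $ i * y $ j * metric_table i j)"

lemma exhaust_5:
  fixes x :: 5
  shows "x = 1 \<or> x = 2 \<or> x = 3 \<or> x = 4 \<or> x = 5"
proof (induct x)
  case (of_int z)
  then have "z = 0 \<or> z = 1 \<or> z = 2 \<or> z = 3 \<or> z = 4" by fastforce
  then show ?case by auto
qed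

lemma forall_5: "(\<forall>i::5. P i) \<longleftrightarrow> P 1 \<and> P 2 \<and> P 3 \<and> P 4 \<and> P 5"
  by (metis exhaust_5)

lemma UNIV_5: "UNIV = {1, 2, 3, 4, 5::5}"
  using exhaust_5 by auto

lemma sum_5: "sum f (UNIV::5 set) = f 1 + f 2 + f 3 + f 4 + f 5"
  unfolding UNIV_5 by (simp add: ac_simps)

lemma bracket5_components:
  "bracket5 x y $ 1 = (x$2 * y$4 - x$4 * y$2) - (x$5 * y$1 - x$1 * y$5) + (x$5 * y$4 - x$4 * y$5)"
  "bracket5 x y $ 2 = (x$4 * y$1 - x$1 * y$4) - (x$5 * y$2 - x$2 * y$5)"
  "bracket5 x y $ 3 = (x$2 * y$1 - x$1 * y$2) + (x$5 * y$1 - x$1 * y$5)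
     - 2 * (x$5 * y$3 - x$3 * y$5) + 7/12 * (x$5 * y$4 - x$4 * y$5)"
  "bracket5 x y $ 4 = 0"
  "bracket5 x y $ 5 = 0"
  by (simp_all add: bracket5_def sum_5 bracket_table_def e_def axis_def)

lemma e_component: "e i $ k = (if k = i then 1 else 0)"
  by (simp add: e_def axis_def)

lemma bracket5_basis: "bracket5 (e i) (e j) = bracket_table i j - bracket_table j i"
proof -
  have "bracket5 (e i) (e j) =
      (\<Sum>k\<in>UNIV. if k = i then
        (\<Sum>l\<in>UNIV. if l = j then bracket_table k l - bracket_table l k else 0) else 0)"
    unfolding bracket5_def by (intro sum.cong refl) (auto simp: e_component simp del: sum.delta sum.delta' intro!: sum.cong)
  then show ?thesis by simp
qed

lemma metric5_basis: "metric5 (e i) (e j) = metric_table i j"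
proof -
  have "metric5 (e i) (e j) =
      (\<Sum>k\<in>UNIV. if k = i then (\<Sum>l\<in>UNIV. if l = j then metric_table k l else 0) else 0)"
    unfolding metric5_def by (intro sum.cong refl) (auto simp: e_component simp del: sum.delta sum.delta' intro!: sum.cong)
  then show ?thesis by simp
qed

lemma bilinear_metric5: "bilinear metric5"
  unfolding bilinear_def
  by (auto intro!: linearI simp: metric5_def algebra_simps sum.distrib sum_distrib_left)

lemma metric5_sym: "metric5 x y = metric5 y x"
  by (simp add: metric5_def sum_5 metric_table_def algebra_simps)

interpretation g: lie_algebra bracket5
proof
  show "bilinear bracket5"
    unfolding bilinear_def
    by (intro conjI allI linearI;
        unfold vec_eq_iff forall_5 bracket5_components vector_add_component vector_scaleR_component
          real_scaleR_def;
        intro conjI; algebra)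
  show "bracket5 x x = 0" for x
    by (simp add: vec_eq_iff forall_5 bracket5_components)
  show "bracket5 x (bracket5 y z) + bracket5 y (bracket5 z x) + bracket5 z (bracket5 x y) = 0"
    for x y z
    unfolding vec_eq_iff forall_5 vector_add_component zero_index bracket5_components
    by (intro conjI; algebra)
qed

end

theory Submission
  imports Defs
begin

text \<open>The nilradical is the Heisenberg ideal spanned by \<open>e 1\<close>, \<open>e 2\<close>, \<open>e 3\<close>
  (\<open>heisenberg5\<close>). It is two-step nilpotent, its derived algebra being the central line through
  \<open>e 3\<close>. No nilpotent ideal is larger: modulo \<open>e 3\<close>, the map \<open>ad x\<close> acts on the plane
  of \<open>e 1\<close>, \<open>e 2\<close> with eigenvalues \<open>- x$5 \<plusminus> \<i> x$4\<close>, and it multiplies \<open>e 3\<close> by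
  \<open>- 2 x$5\<close>; if \<open>x$4\<close> or \<open>x$5\<close> is nonzero, then the ideal generated by \<open>x\<close> meets
  the Heisenberg ideal in a nonzero space on which \<open>ad x\<close> is invertible, and such a space
  survives through the whole lower central series (\<open>recurrent_subset_lower_central\<close>).

  Since the metric has no component pairing \<open>e 4\<close> or \<open>e 5\<close> with \<open>e 1\<close>, \<open>e 2\<close>,
  \<open>e 3\<close>, the complement of the nilradical contains \<open>e 4\<close> and \<open>e 5\<close>, which do not commute.\<close>

lemma (in lie_algebra) nilradical_eqI:
  assumes "lie_ideal N" "nilpotent N"
    and "\<And>I. lie_ideal I \<Longrightarrow> nilpotent I \<Longrightarrow> I \<subseteq> N"
  shows "nilradical = N"
  unfolding nilradical_def using assms by (intro the_equality) blast+

text \<open>Each term of the lower central series contains the brackets of \<open>x\<close> with the previous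
  term, so a set that \<open>ad x\<close> reproduces up to linear combinations is never lost.\<close>

lemma (in lie_algebra) recurrent_subset_lower_central:
  assumes "x \<in> A" "S \<subseteq> A" "S \<subseteq> span (bracket x ` S)"
  shows "S \<subseteq> lower_central A n"
proof (induction n)
  case 0
  show ?case using assms(2) by simp
next
  case (Suc n)
  have "bracket x ` S \<subseteq> {bracket a b | a b. a \<in> A \<and> b \<in> lower_central A n}"
    using Suc assms(1) by blast
  then have "span (bracket x ` S) \<subseteq> lower_central A (Suc n)"
    by (simp add: span_mono)
  then show ?case using assms(3) by blast
qed

lemma (in lie_algebra) nilpotent_recurrent_trivial:
  assumes "nilpotent A" "x \<in> A" "S \<subseteq> A" "S \<subseteq> span (bracket x ` S)"
  shows "S \<subseteq> {0}"
  using recurrent_subset_lower_central[OF assms(2-4)] assms(1)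
  unfolding nilpotent_def by metis

definition heisenberg5 :: "(real ^ 5) set" where
  "heisenberg5 = {x. x $ 4 = 0 \<and> x $ 5 = 0}"

lemma lie_ideal_heisenberg5: "g.lie_ideal heisenberg5"
  by (auto simp: g.lie_ideal_def heisenberg5_def subspace_def bracket5_components)

lemma nilpotent_heisenberg5: "g.nilpotent heisenberg5"
proof -
  let ?center = "{x :: real ^ 5. x $ 1 = 0 \<and> x $ 2 = 0 \<and> x $ 4 = 0 \<and> x $ 5 = 0}"
  have "g.lower_central heisenberg5 1 \<subseteq> ?center"
    unfolding One_nat_def g.lower_central.simps
    by (rule span_minimal) (auto simp: heisenberg5_def bracket5_components subspace_def)
  then have "{bracket5 x y | x y. x \<in> heisenberg5 \<and> y \<in> g.lower_central heisenberg5 1} \<subseteq> {0}"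
    by (auto simp: heisenberg5_def vec_eq_iff forall_5 bracket5_components
        simp del: g.lower_central.simps One_nat_def)
  then have "g.lower_central heisenberg5 (Suc 1) \<subseteq> {0}"
    unfolding g.lower_central.simps(2)[of _ 1] by (intro span_minimal subspace_single_0)
  then have "g.lower_central heisenberg5 (Suc 1) = {0}"
    using span_0 by auto
  then show ?thesis unfolding g.nilpotent_def by blast
qed

lemma nilpotent_ideal_subset_heisenberg5:
  assumes I: "g.lie_ideal I" and nil: "g.nilpotent I"
  shows "I \<subseteq> heisenberg5"
proof
  fix x assume x: "x \<in> I"
  have bracket_I: "bracket5 y x \<in> I" for y
    using I x by (auto simp: g.lie_ideal_def)
  have x5: "x $ 5 = 0"
  proof (rule ccontr)
    assume nz: "x $ 5 \<noteq> 0"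
    let ?z = "bracket5 (e 3) x"
    \<comment> \<open>\<open>?z\<close> is a nonzero multiple of \<open>e 3\<close>, an eigenvector of \<open>ad x\<close>.\<close>
    have "?z = (- 1 / (2 * x $ 5)) *\<^sub>R bracket5 x ?z"
      using nz by (simp add: vec_eq_iff forall_5 bracket5_components e_component)
    then have "?z \<in> span (bracket5 x ` {?z})"
      by (metis image_eqI insertI1 span_base span_scale)
    then have "{?z} \<subseteq> {0}"
      using g.nilpotent_recurrent_trivial[OF nil x, of "{?z}"] bracket_I by blast
    moreover have "?z $ 3 = 2 * x $ 5"
      by (simp add: bracket5_components e_component)
    ultimately show False using nz by simp
  qed
  have x4: "x $ 4 = 0"
  proof (rule ccontr)
    assume nz: "x $ 4 \<noteq> 0"
    let ?u = "bracket5 (e 1) x" and ?v = "bracket5 (e 2) x"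
    \<comment> \<open>As \<open>x $ 5 = 0\<close>, the map \<open>ad x\<close> acts as \<open>x $ 4\<close> times a rotation
      by a right angle on the plane spanned by \<open>?u\<close> and \<open>?v\<close>.\<close>
    have "?u = (- 1 / x $ 4) *\<^sub>R bracket5 x ?v" "?v = (1 / x $ 4) *\<^sub>R bracket5 x ?u"
      using nz x5 by (simp_all add: vec_eq_iff forall_5 bracket5_components e_component)
    then have "{?u, ?v} \<subseteq> span (bracket5 x ` {?u, ?v})"
      by (metis empty_subsetI image_eqI insertI1 insertI2 insert_subset span_base span_scale)
    then have "{?u, ?v} \<subseteq> {0}"
      using g.nilpotent_recurrent_trivial[OF nil x, of "{?u, ?v}"] bracket_I by blast
    moreover have "?v $ 1 = x $ 4"
      using x5 by (simp add: bracket5_components e_component)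
    ultimately show False using nz by simp
  qed
  show "x \<in> heisenberg5" using x4 x5 by (simp add: heisenberg5_def)
qed

lemma nilradical_eq_heisenberg5: "g.nilradical = heisenberg5"
  by (intro g.nilradical_eqI lie_ideal_heisenberg5 nilpotent_heisenberg5
      nilpotent_ideal_subset_heisenberg5)

theorem lemma4p4:
  shows "\<not> (\<exists>A. g.subalgebra A \<and> g.abelian A \<and> orth_compl metric5 g.nilradical \<subseteq> A)"
proof
  assume "\<exists>A. g.subalgebra A \<and> g.abelian A \<and> orth_compl metric5 g.nilradical \<subseteq> A"
  then obtain A where A: "g.abelian A" "orth_compl metric5 heisenberg5 \<subseteq> A"
    unfolding nilradical_eq_heisenberg5 by blast
  have "e 4 \<in> orth_compl metric5 heisenberg5" "e 5 \<in> orth_compl metric5 heisenberg5"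
    by (auto simp: orth_compl_def heisenberg5_def metric5_def sum_5 metric_table_def e_component)
  then have "bracket5 (e 5) (e 4) = 0"
    using A unfolding g.abelian_def by blast
  moreover have "bracket5 (e 5) (e 4) $ 1 = 1"
    by (simp add: bracket5_components e_component)
  ultimately show False by simp
qed

end
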